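(* Let $\mathbf z^1$ be a design and $r\in T'$ a trip, and let $\mathcal A^r(\mathbf z^1)$ be the set of bus legs $(h,l)$ used on the optimal route of $r$ under $\mathbf z^1$. If the rider of trip $r$ adopts the ODMTS under $\mathbf z^1$, then the following inequality is valid: $$\sum_{(h,l)\in\mathcal A^r(\mathbf z^1)}(1-z_{hl})+\sum_{(h,l):z^1_{hl}=0}z_{hl}+\delta^r\ge1.$$ On the other hand, if the rider of trip $r$ does not adopt the ODMTS under $\mathbf z^1$, then the following inequality is valid: $$\sum_{(h,l)\in\mathcal A^r(\mathbf z^1)}(1-z_{hl})+\sum_{(h,l):z^1_{hl}=0}z_{hl}\ge\delta^r.$$
   Context: $N$ is a finite set of nodes, $H\subseteq N$ the set of hubs, $T'$ the set of trips with mode choice. Trip $r$ has distinct origin $or^r$ and destination $de^r$ in $N\setminus H$. For $i,j\in N$, $t_{ij}\ge0$ and $d_{ij}\ge0$ are travel time and distance (possibly asymmetric), each satisfying the triangle inequality. $\theta\in[0,1]$, $g\ge0$ is the shuttle cost per mile, $s\ge0$ the average bus waiting time. Put $\gamma^r_{ij}=(1-\theta)g\,d_{ij}+\theta t_{ij}$ and $\tau^r_{hl}=\theta(t_{hl}+s)$. A design is a $\mathbf z\in\{0,1\}^{|H|\times|H|}$ ($z_{hl}=1$ iff the bus leg from $h$ to $l$ is open); in the design problem it also satisfies weak connectivity $\sum_lz_{hl}=\sum_lz_{lh}$ for all $h\in H$. Given $\mathbf z$, the optimal route of $r$ is a solution of: lexicographically minimize $\langle b^r,f^r\rangle$ (first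 $b^r$, then $f^r$) over binary $x^r_{hl}$ ($h,l\in H$) and $y^r_{ij}$ ($(i,j)\in A^r$), with $b^r=\sum\tau^r_{hl}x^r_{hl}+\sum\gamma^r_{ij}y^r_{ij}$, $f^r=\sum(t_{hl}+s)x^r_{hl}+\sum t_{ij}y^r_{ij}$, subject to $x^r_{hl}\le z_{hl}$ and unit flow conservation from $or^r$ to $de^r$ over bus legs ($x$) and shuttle legs ($y$). Here $A^r=\{(or^r,h),(h,de^r):h\in H\}\cup\{(or^r,de^r)\}$. The trip time is the lexicographically optimal $f^r$ (unique for given $\mathbf z$); if several optimal routes exist, "the" optimal route is any fixed one. With given positive $\alpha^r$, $t^r_{cur}$, the rider of $r$ adopts the system under $\mathbf z$ iff the trip time under $\mathbf z$ is at most $\alpha^rt^r_{cur}$; correspondingly, in the design problem $\delta^r\in\{0,1\}$ is constrained to equal $1$ iff the rider adopts under $\mathbf z$. An inequality in $(\mathbf z,\delta^r)$ is valid if every $(\mathbf z,\delta^r)$ feasible for the design problem satisfies it. *)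

theory Defs
  imports Complex_Main
begin

text \<open>
  Problem data. Quantities indexed by an ordered pair of nodes are functions on pairs, and binary
  variables are real-valued with values in \<open>{0, 1}\<close>. Only the values on the index set of
  a variable (e.g. \<open>hubs P \<times> hubs P\<close> for the design) are ever constrained or summed.
\<close>

record ('n, 'r) odmts =
  nodes :: "'n set"
  hubs :: "'n set"
  trips :: "'r set" \<comment> \<open>the trips with mode choice\<close>
  orig :: "'r \<Rightarrow> 'n"
  dest :: "'r \<Rightarrow> 'n"
  travel_time :: "'n \<times> 'n \<Rightarrow> real"
  distance :: "'n \<times> 'n \<Rightarrow> real"
  theta :: real
  shuttle_cost :: real
  bus_wait :: real
  alpha :: "'r \<Rightarrow> real"
  t_cur :: "'r \<Rightarrow> real"

definition triangle_on :: "'n set \<Rightarrow> ('n \<times> 'n \<Rightarrow> real) \<Rightarrow> bool" where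
  "triangle_on S w \<longleftrightarrow> (\<forall>i\<in>S. \<forall>j\<in>S. \<forall>k\<in>S. w (i, k) \<le> w (i, j) + w (j, k))"

definition wf_odmts :: "('n, 'r) odmts \<Rightarrow> bool" where
  "wf_odmts P \<longleftrightarrow>
     finite (nodes P) \<and> hubs P \<subseteq> nodes P \<and>
     (\<forall>r\<in>trips P. orig P r \<in> nodes P - hubs P \<and> dest P r \<in> nodes P - hubs P \<and>
        orig P r \<noteq> dest P r \<and> alpha P r > 0 \<and> t_cur P r > 0) \<and>
     (\<forall>p\<in>nodes P \<times> nodes P. travel_time P p \<ge> 0 \<and> distance P p \<ge> 0) \<and>
     triangle_on (nodes P) (travel_time P) \<and> triangle_on (nodes P) (distance P) \<and>
     0 \<le> theta P \<and> theta P \<le> 1 \<and> shuttle_cost P \<ge> 0 \<and> bus_wait P \<ge> 0"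

definition bus_legs :: "('n, 'r) odmts \<Rightarrow> ('n \<times> 'n) set" where
  "bus_legs P = hubs P \<times> hubs P"

definition shuttle_legs :: "('n, 'r) odmts \<Rightarrow> 'r \<Rightarrow> ('n \<times> 'n) set" where
  "shuttle_legs P r =
     {(orig P r, h) | h. h \<in> hubs P} \<union> {(h, dest P r) | h. h \<in> hubs P} \<union> {(orig P r, dest P r)}"

definition gamma :: "('n, 'r) odmts \<Rightarrow> 'n \<times> 'n \<Rightarrow> real" where
  "gamma P p = (1 - theta P) * shuttle_cost P * distance P p + theta P * travel_time P p"

definition tau :: "('n, 'r) odmts \<Rightarrow> 'n \<times> 'n \<Rightarrow> real" where
  "tau P p = theta P * (travel_time P p + bus_wait P)"

definition binary_on :: "'a set \<Rightarrow> ('a \<Rightarrow> real) \<Rightarrow> bool" where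
  "binary_on S v \<longleftrightarrow> (\<forall>p\<in>S. v p \<in> {0, 1})"

definition design :: "('n, 'r) odmts \<Rightarrow> ('n \<times> 'n \<Rightarrow> real) \<Rightarrow> bool" where
  "design P z \<longleftrightarrow> binary_on (bus_legs P) z"

definition weakly_connected :: "('n, 'r) odmts \<Rightarrow> ('n \<times> 'n \<Rightarrow> real) \<Rightarrow> bool" where
  "weakly_connected P z \<longleftrightarrow>
     (\<forall>h\<in>hubs P. (\<Sum>l\<in>hubs P. z (h, l)) = (\<Sum>l\<in>hubs P. z (l, h)))"

definition net_outflow :: "('n \<times> 'n) set \<Rightarrow> ('n \<times> 'n \<Rightarrow> real) \<Rightarrow> 'n \<Rightarrow> real" where
  "net_outflow E v i = (\<Sum>j | (i, j) \<in> E. v (i, j)) - (\<Sum>j | (j, i) \<in> E. v (j, i))"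

definition feasible_route ::
  "('n, 'r) odmts \<Rightarrow> 'r \<Rightarrow> ('n \<times> 'n \<Rightarrow> real) \<Rightarrow> ('n \<times> 'n \<Rightarrow> real) \<Rightarrow> ('n \<times> 'n \<Rightarrow> real) \<Rightarrow> bool"
where
  "feasible_route P r z x y \<longleftrightarrow>
     binary_on (bus_legs P) x \<and> binary_on (shuttle_legs P r) y \<and>
     (\<forall>p\<in>bus_legs P. x p \<le> z p) \<and>
     (\<forall>i\<in>nodes P. net_outflow (bus_legs P) x i + net_outflow (shuttle_legs P r) y i =
        (if i = orig P r then 1 else if i = dest P r then - 1 else 0))"

definition route_cost ::
  "('n, 'r) odmts \<Rightarrow> 'r \<Rightarrow> ('n \<times> 'n \<Rightarrow> real) \<Rightarrow> ('n \<times> 'n \<Rightarrow> real) \<Rightarrow> real" where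
  "route_cost P r x y =
     (\<Sum>p\<in>bus_legs P. tau P p * x p) + (\<Sum>p\<in>shuttle_legs P r. gamma P p * y p)"

definition route_time ::
  "('n, 'r) odmts \<Rightarrow> 'r \<Rightarrow> ('n \<times> 'n \<Rightarrow> real) \<Rightarrow> ('n \<times> 'n \<Rightarrow> real) \<Rightarrow> real" where
  "route_time P r x y =
     (\<Sum>p\<in>bus_legs P. (travel_time P p + bus_wait P) * x p) +
     (\<Sum>p\<in>shuttle_legs P r. travel_time P p * y p)"

definition optimal_route ::
  "('n, 'r) odmts \<Rightarrow> 'r \<Rightarrow> ('n \<times> 'n \<Rightarrow> real) \<Rightarrow> ('n \<times> 'n \<Rightarrow> real) \<Rightarrow> ('n \<times> 'n \<Rightarrow> real) \<Rightarrow> bool"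
where
  "optimal_route P r z x y \<longleftrightarrow>
     feasible_route P r z x y \<and>
     (\<forall>x' y'. feasible_route P r z x' y' \<longrightarrow>
        route_cost P r x y < route_cost P r x' y' \<or>
        (route_cost P r x y = route_cost P r x' y' \<and> route_time P r x y \<le> route_time P r x' y'))"

definition used_bus_legs :: "('n, 'r) odmts \<Rightarrow> ('n \<times> 'n \<Rightarrow> real) \<Rightarrow> ('n \<times> 'n) set" where
  "used_bus_legs P x = {p \<in> bus_legs P. x p = 1}"

text \<open>
  The description below determines a value for every well-formed instance, trip of the instance
  and design: the direct shuttle is a feasible route, there are finitely many routes up to
  irrelevant values, and lexicographic optima share the same time.
\<close>

definition trip_time :: "('n, 'r) odmts \<Rightarrow> 'r \<Rightarrow> ('n \<times> 'n \<Rightarrow> real) \<Rightarrow> real" where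
  "trip_time P r z = (THE f. \<exists>x y. optimal_route P r z x y \<and> f = route_time P r x y)"

definition adopts :: "('n, 'r) odmts \<Rightarrow> 'r \<Rightarrow> ('n \<times> 'n \<Rightarrow> real) \<Rightarrow> bool" where
  "adopts P r z \<longleftrightarrow> trip_time P r z \<le> alpha P r * t_cur P r"

definition design_feasible ::
  "('n, 'r) odmts \<Rightarrow> ('n \<times> 'n \<Rightarrow> real) \<Rightarrow> ('r \<Rightarrow> real) \<Rightarrow> bool" where
  "design_feasible P z \<delta> \<longleftrightarrow>
     design P z \<and> weakly_connected P z \<and> binary_on (trips P) \<delta> \<and>
     (\<forall>r\<in>trips P. \<delta> r = 1 \<longleftrightarrow> adopts P r z)"

definition valid_inequality ::
  "('n, 'r) odmts \<Rightarrow> 'r \<Rightarrow> (('n \<times> 'n \<Rightarrow> real) \<Rightarrow> real \<Rightarrow> bool) \<Rightarrow> bool" where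
  "valid_inequality P r Q \<longleftrightarrow> (\<forall>z \<delta>. design_feasible P z \<delta> \<longrightarrow> Q z (\<delta> r))"

end

theory Submission
  imports Defs
begin

text \<open>
  The left-hand side common to both inequalities counts the legs of the route that are closed in
  \<open>z\<close> and the legs closed in \<open>z1\<close> that are open in \<open>z\<close>.
  If it vanishes, \<open>z\<close> opens only legs that \<open>z1\<close> opens but keeps the optimal
  route intact, so this route is still optimal under \<open>z\<close> and the adoption decision is the
  same. Otherwise it is at least 1, and both inequalities hold since \<open>\<delta>\<^sup>r\<close> is
  binary.
\<close>

text \<open>Two lexicographic optima compare with each other in both directions, which forces equal
  costs and then equal times; hence any optimum determines the definite description.\<close>

lemma trip_time_eq_route_time:
  assumes "optimal_route P r z x y"
  shows "trip_time P r z = route_time P r x y"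
  unfolding trip_time_def
proof (rule the_equality)
  show "\<exists>x' y'. optimal_route P r z x' y' \<and> route_time P r x y = route_time P r x' y'"
    using assms by blast
next
  fix f
  assume "\<exists>x' y'. optimal_route P r z x' y' \<and> f = route_time P r x' y'"
  then show "f = route_time P r x y"
    using assms unfolding optimal_route_def by fastforce
qed

lemma feasible_route_mono:
  assumes "feasible_route P r z x y" and "\<And>p. p \<in> bus_legs P \<Longrightarrow> z p \<le> z' p"
  shows "feasible_route P r z' x y"
  using assms unfolding feasible_route_def by (meson order_trans)

text \<open>Since \<open>z\<close> lies below \<open>z'\<close>, every competitor under
  \<open>z\<close> already competes under \<open>z'\<close>. A minimizer over the larger set that
  survives in the smaller one is still a minimizer there.\<close>

lemma optimal_route_restrict:
  assumes "optimal_route P r z' x y"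
    and "\<And>p. p \<in> bus_legs P \<Longrightarrow> x p \<le> z p"
    and "\<And>p. p \<in> bus_legs P \<Longrightarrow> z p \<le> z' p"
  shows "optimal_route P r z x y"
proof -
  have "feasible_route P r z x y"
    using assms(1,2) by (simp add: optimal_route_def feasible_route_def)
  moreover have "feasible_route P r z' x' y'" if "feasible_route P r z x' y'" for x' y'
    using that assms(3) by (rule feasible_route_mono)
  ultimately show ?thesis
    using assms(1) by (simp add: optimal_route_def)
qed

lemma adopts_restrict_iff:
  assumes "optimal_route P r z' x y"
    and "\<And>p. p \<in> bus_legs P \<Longrightarrow> x p \<le> z p"
    and "\<And>p. p \<in> bus_legs P \<Longrightarrow> z p \<le> z' p"
  shows "adopts P r z \<longleftrightarrow> adopts P r z'"
  using trip_time_eq_route_time[OF assms(1)]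
    trip_time_eq_route_time[OF optimal_route_restrict[OF assms]]
  by (simp add: adopts_def)

lemma finite_bus_legs: "wf_odmts P \<Longrightarrow> finite (bus_legs P)"
  unfolding wf_odmts_def bus_legs_def by (meson finite_SigmaI finite_subset)

lemma cut_nonneg:
  assumes "design P z"
  shows "(\<Sum>p\<in>used_bus_legs P x. 1 - z p) \<ge> 0"
    and "(\<Sum>p | p \<in> bus_legs P \<and> z1 p = 0. z p) \<ge> 0"
  using assms
  by (auto simp: design_def binary_on_def used_bus_legs_def intro!: sum_nonneg)

text \<open>The disjunction does not mention whether the rider adopts under \<open>z1\<close>, so it
  serves both inequalities.\<close>

lemma cut_ge_1_or_adopts_iff:
  assumes wf: "wf_odmts P"
    and z1: "design P z1" and z: "design P z"
    and opt: "optimal_route P r z1 x y"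
  shows "(\<Sum>p\<in>used_bus_legs P x. 1 - z p) + (\<Sum>p | p \<in> bus_legs P \<and> z1 p = 0. z p) \<ge> 1 \<or>
    (adopts P r z \<longleftrightarrow> adopts P r z1)"
    (is "?closed + ?opened \<ge> 1 \<or> _")
proof -
  have fin: "finite (used_bus_legs P x)" "finite {p \<in> bus_legs P. z1 p = 0}"
    using finite_bus_legs[OF wf] by (simp_all add: used_bus_legs_def)
  have bin: "z p = 0 \<or> z p = 1" "z1 p = 0 \<or> z1 p = 1" "x p = 0 \<or> x p = 1"
    if "p \<in> bus_legs P" for p
    using that z z1 opt
    by (auto simp: design_def binary_on_def optimal_route_def feasible_route_def)
  have closed_terms: "0 \<le> 1 - z p" if "p \<in> used_bus_legs P x" for p
    using that bin(1)[of p] by (auto simp: used_bus_legs_def)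
  have opened_terms: "0 \<le> z p" if "p \<in> {p \<in> bus_legs P. z1 p = 0}" for p
    using that bin(1)[of p] by auto
  note nonneg = cut_nonneg[OF z]
  \<comment> \<open>As \<open>z\<close> is binary, every summand is 0 or 1: either some summand of
    one of the sums is 1, or all of them vanish.\<close>
  consider (closed) p where "p \<in> used_bus_legs P x" "z p = 0"
    | (opened) p where "p \<in> {p \<in> bus_legs P. z1 p = 0}" "z p = 1"
    | (intact) "\<forall>p\<in>used_bus_legs P x. z p = 1" "\<forall>p\<in>bus_legs P. z1 p = 0 \<longrightarrow> z p = 0"
    using bin(1) by (force simp: used_bus_legs_def)
  then show ?thesis
  proof cases
    case closed
    have "1 - z p \<le> ?closed"
      using closed(1) closed_terms fin(1) by (intro member_le_sum) auto
    then show ?thesis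
      using closed(2) nonneg(2)[of z1] by simp
  next
    case opened
    have "z p \<le> ?opened"
      using opened(1) opened_terms fin(2) by (intro member_le_sum) auto
    then show ?thesis
      using opened(2) nonneg(1)[of x] by simp
  next
    case intact
    \<comment> \<open>For binary values these inequalities are just the implications
      \<open>x p = 1\<close> to \<open>z p = 1\<close> and \<open>z1 p = 0\<close> to
      \<open>z p = 0\<close>.\<close>
    have "x p \<le> z p" "z p \<le> z1 p" if "p \<in> bus_legs P" for p
    proof -
      have "x p = 1 \<longrightarrow> z p = 1" "z1 p = 0 \<longrightarrow> z p = 0"
        using that intact unfolding used_bus_legs_def by blast+
      then show "x p \<le> z p" "z p \<le> z1 p"
        using bin[OF that] by auto
    qed
    then show ?thesis
      using adopts_restrict_iff[OF opt, of z] by simp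
  qed
qed

text \<open>The inequality sees the adoption vector through its entry at \<open>r\<close>, so a
  single binary number \<open>d\<close> can stand for it.\<close>

lemma valid_inequalityI:
  assumes "r \<in> trips P"
    and "\<And>z d. design P z \<Longrightarrow> d \<in> {0, 1} \<Longrightarrow> d = 1 \<longleftrightarrow> adopts P r z \<Longrightarrow> Q z d"
  shows "valid_inequality P r Q"
  using assms by (auto simp: valid_inequality_def design_feasible_def binary_on_def)

theorem proposition13:
  fixes P :: "('n, 'r) odmts" and r :: 'r and z1 x y :: "'n \<times> 'n \<Rightarrow> real"
  assumes "wf_odmts P"
    and "r \<in> trips P"
    and "design P z1"
    and "optimal_route P r z1 x y"
  shows "(adopts P r z1 \<longrightarrow>
            valid_inequality P r (\<lambda>z \<delta>r.
              (\<Sum>p\<in>used_bus_legs P x. 1 - z p) +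
              (\<Sum>p | p \<in> bus_legs P \<and> z1 p = 0. z p) + \<delta>r \<ge> 1)) \<and>
         (\<not> adopts P r z1 \<longrightarrow>
            valid_inequality P r (\<lambda>z \<delta>r.
              (\<Sum>p\<in>used_bus_legs P x. 1 - z p) +
              (\<Sum>p | p \<in> bus_legs P \<and> z1 p = 0. z p) \<ge> \<delta>r))"
proof (intro conjI impI; rule valid_inequalityI[OF assms(2)])
  fix z and d :: real
  assume z: "design P z" and d: "d \<in> {0, 1}" "d = 1 \<longleftrightarrow> adopts P r z"
  \<comment> \<open>Nonnegativity settles the case where the adoption decisions agree: then
    \<open>d\<close> is 1 in the first inequality and 0 in the second.\<close>
  note cut = cut_ge_1_or_adopts_iff[OF assms(1,3) z assms(4)] cut_nonneg(1)[OF z, of x]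
    cut_nonneg(2)[OF z, of z1]
  show "(\<Sum>p\<in>used_bus_legs P x. 1 - z p) + (\<Sum>p | p \<in> bus_legs P \<and> z1 p = 0. z p) + d \<ge> 1"
    if "adopts P r z1"
    using that cut d by auto
  show "(\<Sum>p\<in>used_bus_legs P x. 1 - z p) + (\<Sum>p | p \<in> bus_legs P \<and> z1 p = 0. z p) \<ge> d"
    if "\<not> adopts P r z1"
    using that cut d by auto
qed

end
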